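(* Let $K$ be a nonnegative integer or $K=\infty$, let $P_0\ge0$, and let $I_1\ge I_2\ge\cdots\ge I_K\ge0$ with $\sum_{i=1}^KI_i<\infty$. The symmetric rate under Gaussian point-to-point codes, $R_{\mathrm{sym}}=\sup\{R\ge0:\ (R,R,\dots,R)\in\mathcal C_0\}$, satisfies $$R_{\mathrm{sym}}=\max_{k\in[0:K]}\ \min_{l\in[0:k]}\ \frac1{l+1}\,C\!\left(\frac{P_0+I[k-l+1:k]}{1+I[k+1:K]}\right).$$
   Context: $C(x)=\log_2(1+x)$; $[a:b]$ is the set of integers from $a$ to $b$ (for $K=\infty$, $[0:K]$ is the set of all nonnegative integers); $I[j:k]=\sum_{i=j}^kI_i$ (zero for an empty range). Here $P_0$ is the received power at the tagged receiver $0$ from its own (tagged) transmitter $0$, and $I_i$ is the received power from interferer $i\ge1$; the noise power is $1$. The region $\mathcal C_0$ (the capacity region with Gaussian point-to-point codes for decoding transmitter $0$'s message at receiver $0$) is $$\mathcal C_0=\{\mathbf R:\ R_{\mathcal S}\in\mathcal A(\mathcal S)\text{ for some }\mathcal S\subseteq[0:K]\text{ with }0\in\mathcal S\},$$ where $\mathbf R=(R_l)_{l\in[0:K]}$ has nonnegative entries, $R_{\mathcal S}=(R_l)_{l\in\mathcal S}$, and, writing $P(\mathcal T)$ for the sum of received powers of the transmitters in $\mathcal T$ (that is, $P_0$ for index $0$ and $I_i$ for index $i\ge1$), $$\mathcal A(\mathcal S)=\left\{R_{\mathcal S}:\ \sum_{l\in\mathcal T}R_l\le C\!\left(\frac{P(\mathcal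 T)}{1+P([0:K]\setminus\mathcal S)}\right)\text{ for every }\mathcal T\subseteq\mathcal S\right\}.$$ *)

theory Defs
  imports "HOL-Analysis.Analysis" "HOL-Library.Extended_Nat"
begin

definition C :: "real \<Rightarrow> real" where
  "C x = log 2 (1 + x)"

definition users :: "enat \<Rightarrow> nat set" where
  "users K = {i. enat i \<le> K}"

definition range_sum :: "(nat \<Rightarrow> real) \<Rightarrow> nat \<Rightarrow> enat \<Rightarrow> real" where
  "range_sum I j k = (\<Sum>\<^sub>\<infinity>i\<in>{i. j \<le> i \<and> enat i \<le> k}. I i)"

definition received_power :: "real \<Rightarrow> (nat \<Rightarrow> real) \<Rightarrow> nat set \<Rightarrow> real" where
  "received_power P0 I T = (\<Sum>\<^sub>\<infinity>i\<in>T. if i = 0 then P0 else I i)"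

text \<open>
  Rate vectors are functions on \<^typ>\<open>nat\<close>; membership in \<open>mac_region\<close> depends only on the
  entries in \<open>S\<close>, and membership in \<open>capacity_region\<close> only on those in \<open>users K\<close>.
  If \<open>K = \<infinity>\<close>, the sets \<open>S\<close> and \<open>T\<close> may be infinite. A divergent sum of nonnegative rates
  is infinite and so exceeds the finite bound; \<^const>\<open>infsum\<close> would silently be \<open>0\<close> there,
  hence the explicit summability condition.
\<close>

definition mac_region :: "enat \<Rightarrow> real \<Rightarrow> (nat \<Rightarrow> real) \<Rightarrow> nat set \<Rightarrow> (nat \<Rightarrow> real) set" where
  "mac_region K P0 I S =
     {R. \<forall>T\<subseteq>S. R summable_on T \<and>
        (\<Sum>\<^sub>\<infinity>l\<in>T. R l)
          \<le> C (received_power P0 I T / (1 + received_power P0 I (users K - S)))}"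

definition capacity_region :: "enat \<Rightarrow> real \<Rightarrow> (nat \<Rightarrow> real) \<Rightarrow> (nat \<Rightarrow> real) set" where
  "capacity_region K P0 I =
     {R. (\<forall>l\<in>users K. 0 \<le> R l) \<and> (\<exists>S\<subseteq>users K. 0 \<in> S \<and> R \<in> mac_region K P0 I S)}"

definition symmetric_rates :: "enat \<Rightarrow> real \<Rightarrow> (nat \<Rightarrow> real) \<Rightarrow> real set" where
  "symmetric_rates K P0 I = {R. 0 \<le> R \<and> (\<lambda>_. R) \<in> capacity_region K P0 I}"

definition R_sym :: "enat \<Rightarrow> real \<Rightarrow> (nat \<Rightarrow> real) \<Rightarrow> real" where
  "R_sym K P0 I = Sup (symmetric_rates K P0 I)"

definition joint_decoding_rate :: "enat \<Rightarrow> real \<Rightarrow> (nat \<Rightarrow> real) \<Rightarrow> nat \<Rightarrow> real" where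
  "joint_decoding_rate K P0 I k =
     (MIN l\<in>{0..k}. 1 / real (l + 1) *
        C ((P0 + range_sum I (k - l + 1) (enat k)) / (1 + range_sum I (k + 1) K)))"

text \<open>The facts below show that the real supremum in \<open>R_sym\<close> is a genuine one.\<close>

lemma received_power_nonneg:
  assumes "0 \<le> P0" and "\<And>i. 1 \<le> i \<Longrightarrow> enat i \<le> K \<Longrightarrow> 0 \<le> I i" and "T \<subseteq> users K"
  shows "0 \<le> received_power P0 I T"
  unfolding received_power_def
  by (rule infsum_nonneg) (use assms in \<open>auto simp: users_def\<close>)

lemma symmetric_rates_nonempty:
  assumes "0 \<le> P0" and "\<And>i. 1 \<le> i \<Longrightarrow> enat i \<le> K \<Longrightarrow> 0 \<le> I i"
  shows "symmetric_rates K P0 I \<noteq> {}"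
proof -
  have z: "0 \<in> users K" by (simp add: users_def zero_enat_def[symmetric])
  have "0 \<le> C (received_power P0 I T / (1 + received_power P0 I (users K - {0})))"
    if "T \<subseteq> {0}" for T
  proof -
    have "0 \<le> received_power P0 I T" "0 \<le> received_power P0 I (users K - {0})"
      by (rule received_power_nonneg[OF assms, where K = K]; use that z in blast)+
    then have "0 \<le> received_power P0 I T / (1 + received_power P0 I (users K - {0}))" by simp
    then show ?thesis by (simp add: C_def)
  qed
  then have "(\<lambda>_. 0) \<in> mac_region K P0 I {0}"
    by (auto simp: mac_region_def)
  then have "0 \<in> symmetric_rates K P0 I"
    using z by (auto simp: symmetric_rates_def capacity_region_def)
  then show ?thesis by blast
qed

lemma symmetric_rates_bdd_above:
  assumes "0 \<le> P0" and "\<And>i. 1 \<le> i \<Longrightarrow> enat i \<le> K \<Longrightarrow> 0 \<le> I i"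
  shows "bdd_above (symmetric_rates K P0 I)"
proof (rule bdd_aboveI[where M = "C P0"])
  fix R assume "R \<in> symmetric_rates K P0 I"
  then obtain S where S: "0 \<in> S" "(\<lambda>_. R) \<in> mac_region K P0 I S"
    by (auto simp: symmetric_rates_def capacity_region_def)
  let ?N = "received_power P0 I (users K - S)"
  have N: "0 \<le> ?N"
    by (rule received_power_nonneg[OF assms, where K = K]) auto
  have "(\<Sum>\<^sub>\<infinity>l\<in>{0::nat}. R) \<le> C (received_power P0 I {0} / (1 + ?N))"
    using S unfolding mac_region_def by blast
  then have "R \<le> C (P0 / (1 + ?N))"
    by (simp add: received_power_def)
  also have "\<dots> \<le> C P0"
  proof -
    have "P0 / (1 + ?N) \<le> P0 / 1" using assms(1) N by (intro divide_left_mono) auto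
    moreover have "0 \<le> P0 / (1 + ?N)" using assms(1) N by simp
    ultimately show ?thesis using assms(1) by (simp add: C_def)
  qed
  finally show "R \<le> C P0" .
qed

end

theory Submission
  imports Defs
begin

text \<open>
  A constant positive rate is not summable over an infinite set, so only finite decoding sets
  matter. If a set \<open>S\<close> satisfies all constraints for sets \<open>T\<close> containing \<open>0\<close> but violates
  one for some \<open>U\<close> not containing \<open>0\<close>, then by the chain rule for \<^const>\<open>C\<close> the
  set \<open>S - U\<close>, with \<open>U\<close> treated as noise, again satisfies all constraints containing \<open>0\<close>.
  Hence the constraints avoiding \<open>0\<close> may be dropped. Since the powers decrease, among the sets
  with \<open>k\<close> interferers \<open>{0..k}\<close> is the best one, and the tightest constraint of size
  \<open>l + 1\<close> in it is given by the \<open>l\<close> weakest interferers. The maximum exists for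
  \<open>K = \<infinity>\<close> because the \<open>k\<close>th rate is \<open>O(1 / k)\<close>.
\<close>

section \<open>Capacity splitting and an exchange inequality\<close>

lemma C_chain_rule:
  assumes "0 \<le> a" "0 \<le> b" "0 \<le> n"
  shows "C ((a + b) / (1 + n)) = C (b / (1 + n)) + C (a / (1 + (n + b)))"
proof -
  \<comment> \<open>The factors are \<open>(1 + n + b) / (1 + n)\<close> and
    \<open>(1 + n + b + a) / (1 + n + b)\<close>, which telescope; the logarithm turns their product
    into a sum.\<close>
  have "1 + (a + b) / (1 + n) = (1 + b / (1 + n)) * (1 + a / (1 + (n + b)))"
    using assms by (simp add: divide_simps) (simp add: algebra_simps)
  moreover have "0 < 1 + b / (1 + n)" "0 < 1 + a / (1 + (n + b))"
    using assms by (simp_all add: add_pos_nonneg)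
  ultimately show ?thesis
    by (simp add: C_def log_mult)
qed

lemma C_mono: "0 \<le> x \<Longrightarrow> x \<le> y \<Longrightarrow> C x \<le> C y"
  by (simp add: C_def)

lemma C_nonneg: "0 \<le> x \<Longrightarrow> 0 \<le> C x"
  by (simp add: C_def)

text \<open>The common part contributes equally to both sums, and equal cardinality yields a
  bijection between the two differences, along which the terms compare one by one.\<close>

lemma sum_le_of_exchange:
  fixes f :: "'a \<Rightarrow> real"
  assumes fin: "finite A" "finite B" and card: "card A = card B"
    and le: "\<And>a b. a \<in> A - B \<Longrightarrow> b \<in> B - A \<Longrightarrow> f a \<le> f b"
  shows "sum f A \<le> sum f B"
proof -
  have "card (A - B) = card (B - A)"
    using card fin by (simp add: card_Diff_subset_Int Int_commute)
  then obtain h where h: "bij_betw h (A - B) (B - A)"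
    using fin by (metis finite_Diff finite_same_card_bij)
  have "sum f (A - B) \<le> (\<Sum>a\<in>A - B. f (h a))"
    using le h by (intro sum_mono) (metis bij_betwE)
  also have "\<dots> = sum f (B - A)"
    using h by (rule sum.reindex_bij_betw)
  finally show ?thesis
    using sum.Int_Diff[OF fin(1), of f B] sum.Int_Diff[OF fin(2), of f A]
    by (simp add: Int_commute)
qed

section \<open>Received powers and noise\<close>

context
  fixes K :: enat and P0 :: real and I :: "nat \<Rightarrow> real"
  assumes P0: "0 \<le> P0"
    and I_nonneg: "\<And>i. 1 \<le> i \<Longrightarrow> enat i \<le> K \<Longrightarrow> 0 \<le> I i"
    and I_step: "\<And>i. 1 \<le> i \<Longrightarrow> enat (Suc i) \<le> K \<Longrightarrow> I (Suc i) \<le> I i"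
    and I_summable: "I summable_on {i. 1 \<le> i \<and> enat i \<le> K}"
begin

abbreviation P :: "nat set \<Rightarrow> real" where
  "P \<equiv> received_power P0 I"

abbreviation noise :: "nat set \<Rightarrow> real" where
  "noise S \<equiv> P (users K - S)"

text \<open>The relaxed region at a constant rate. Finiteness makes \<open>card\<close> meaningful
  and lets an induction shrink \<open>S\<close>.\<close>

definition decodes_tagged :: "nat set \<Rightarrow> real \<Rightarrow> bool" where
  "decodes_tagged S R \<longleftrightarrow> finite S \<and> S \<subseteq> users K \<and> 0 \<in> S \<and>
     (\<forall>T\<subseteq>S. 0 \<in> T \<longrightarrow> real (card T) * R \<le> C (P T / (1 + noise S)))"

lemma zero_user: "0 \<in> users K"
  by (simp add: users_def zero_enat_def[symmetric])

lemma users_downward: "j \<in> users K \<Longrightarrow> i \<le> j \<Longrightarrow> i \<in> users K"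
  unfolding users_def by (metis enat_ord_simps(1) mem_Collect_eq order_trans)

lemma I_antimono:
  assumes "1 \<le> i" "i \<le> j" "j \<in> users K"
  shows "I j \<le> I i"
  using assms(2,3)
proof (induction j rule: dec_induct)
  case (step n)
  then have "n \<in> users K" by (meson users_downward le_Suc_eq order_refl)
  moreover have "I (Suc n) \<le> I n"
    using step assms(1) by (intro I_step) (auto simp: users_def)
  ultimately show ?case using step.IH by simp
qed simp

lemma P_nonneg: "T \<subseteq> users K \<Longrightarrow> 0 \<le> P T"
  by (rule received_power_nonneg[OF P0 I_nonneg])

lemma P_finite: "finite T \<Longrightarrow> P T = (\<Sum>i\<in>T. if i = 0 then P0 else I i)"
  by (simp add: received_power_def)

lemma P_insert_zero:
  "finite T \<Longrightarrow> 0 \<notin> T \<Longrightarrow> P (insert 0 T) = P0 + sum I T"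
  by (auto simp: P_finite intro!: sum.cong)

text \<open>For infinite \<open>K\<close> the noise comes from infinitely many users; summability
  over all users is what makes \<open>P\<close> additive and monotone there.\<close>

lemma power_summable: "(\<lambda>i. if i = 0 then P0 else I i) summable_on users K"
proof -
  have "users K = insert 0 {i. 1 \<le> i \<and> enat i \<le> K}"
    using zero_user by (auto simp: users_def)
  moreover have "(\<lambda>i. if i = 0 then P0 else I i) summable_on {i. 1 \<le> i \<and> enat i \<le> K}"
    using I_summable by (rule summable_on_cong[THEN iffD1, rotated]) auto
  moreover have "(\<lambda>i. if i = 0 then P0 else I i) summable_on {0}" by simp
  ultimately show ?thesis
    by (metis insert_is_Un summable_on_union)
qed

lemma P_Un_disjoint:
  assumes "A \<subseteq> users K" "B \<subseteq> users K" "A \<inter> B = {}"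
  shows "P (A \<union> B) = P A + P B"
  unfolding received_power_def
  by (rule infsum_Un_disjoint)
    (use assms power_summable summable_on_subset_banach in blast)+

lemma P_mono: "A \<subseteq> B \<Longrightarrow> B \<subseteq> users K \<Longrightarrow> P A \<le> P B"
  using P_Un_disjoint[of A "B - A"] P_nonneg[of "B - A"] by (force simp: Un_absorb1)

lemma noise_eq: "S \<subseteq> users K \<Longrightarrow> noise S = P (users K) - P S"
  using P_Un_disjoint[of S "users K - S"] by (simp add: Un_absorb1)

lemma SNR_nonneg: "T \<subseteq> users K \<Longrightarrow> 0 \<le> P T / (1 + noise S)"
  using P_nonneg[of T] P_nonneg[of "users K - S"] by simp

lemma range_sum_finite: "range_sum I j (enat k) = sum I {j..k}"
proof -
  have "{i. j \<le> i \<and> enat i \<le> enat k} = {j..k}" by auto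
  then show ?thesis by (simp add: range_sum_def)
qed

lemma range_sum_noise: "range_sum I (k + 1) K = noise {0..k}"
  unfolding range_sum_def received_power_def
  by (rule infsum_cong_neutral) (auto simp: users_def)

lemma joint_decoding_rate_eq:
  "joint_decoding_rate K P0 I k =
     (MIN l\<in>{0..k}. 1 / real (l + 1) * C ((P0 + sum I {k - l + 1..k}) / (1 + noise {0..k})))"
  by (simp only: joint_decoding_rate_def range_sum_finite range_sum_noise)

section \<open>Removing the constraints that avoid the tagged user\<close>

lemma decodes_tagged_imp_symmetric_rate:
  assumes "0 \<le> R" "decodes_tagged S R"
  shows "R \<in> symmetric_rates K P0 I"
proof -
  have "finite S" using assms(2) by (simp add: decodes_tagged_def)
  then show ?thesis
    using assms(2)
  proof (induction S rule: finite_psubset_induct)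
    case (psubset S)
    then have S: "S \<subseteq> users K" "0 \<in> S"
      and tagged: "\<And>T. T \<subseteq> S \<Longrightarrow> 0 \<in> T \<Longrightarrow> real (card T) * R \<le> C (P T / (1 + noise S))"
      by (auto simp: decodes_tagged_def)
    show ?case
    proof (cases "\<forall>T\<subseteq>S. real (card T) * R \<le> C (P T / (1 + noise S))")
      case True
      then have "(\<lambda>_. R) \<in> mac_region K P0 I S"
        using psubset.hyps by (auto simp: mac_region_def finite_subset)
      with S assms(1) show ?thesis
        by (auto simp: symmetric_rates_def capacity_region_def)
    next
      case False
      obtain U where U: "U \<subseteq> S" and viol: "C (P U / (1 + noise S)) < real (card U) * R"
        using False by (meson not_le)
      have "0 \<notin> U" using tagged[OF U] viol by force
      \<comment> \<open>The constraint for the empty set reads 0 \<le> 0 and cannot be violated. So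
        \<open>S - U\<close> is strictly smaller and the induction hypothesis applies.\<close>
      have "U \<noteq> {}" using viol by (auto simp: received_power_def C_def)
      have "noise (S - U) = noise S + P U"
      proof -
        have "users K - (S - U) = (users K - S) \<union> U" using U S by blast
        moreover have "P ((users K - S) \<union> U) = noise S + P U"
          using U S by (intro P_Un_disjoint) auto
        ultimately show ?thesis by simp
      qed
      \<comment> \<open>The set \<open>T \<union> U\<close> contains 0, so its constraint holds. The
        chain rule splits off the term of \<open>U\<close>, and subtracting the violated bound
        leaves the constraint for \<open>T\<close> with \<open>U\<close> as noise.\<close>
      have "real (card T) * R \<le> C (P T / (1 + noise (S - U)))" if T: "T \<subseteq> S - U" "0 \<in> T" for T
      proof -
        have fin: "finite T" "finite U" using T U psubset.hyps by (auto intro: finite_subset)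
        have "T \<inter> U = {}" using T by blast
        then have "real (card T) * R + real (card U) * R = real (card (T \<union> U)) * R"
          using fin by (simp add: card_Un_disjoint algebra_simps)
        also have "\<dots> \<le> C (P (T \<union> U) / (1 + noise S))"
          using T U by (intro tagged) auto
        also have "P (T \<union> U) = P T + P U"
          using T U S by (intro P_Un_disjoint) auto
        also have "C ((P T + P U) / (1 + noise S))
            = C (P U / (1 + noise S)) + C (P T / (1 + (noise S + P U)))"
          using T U S by (intro C_chain_rule P_nonneg) auto
        finally show ?thesis using viol \<open>noise (S - U) = _\<close> by simp
      qed
      then have "decodes_tagged (S - U) R"
        using S \<open>0 \<notin> U\<close> psubset.hyps by (auto simp: decodes_tagged_def)
      moreover have "S - U \<subset> S" using U \<open>U \<noteq> {}\<close> by blast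
      ultimately show ?thesis by (rule psubset.IH[rotated])
    qed
  qed
qed

section \<open>Achievability by decoding the strongest interferers\<close>

lemma joint_decoding_rate_nonneg:
  assumes "k \<in> users K"
  shows "0 \<le> joint_decoding_rate K P0 I k"
proof -
  have "0 \<le> sum I {k - l + 1..k}" for l
    using assms by (intro sum_nonneg I_nonneg) (use users_downward in \<open>auto simp: users_def\<close>)
  then show ?thesis
    unfolding joint_decoding_rate_eq using P0 P_nonneg[of "users K - {0..k}"]
    by (intro Min.boundedI) (auto intro!: C_nonneg divide_nonneg_nonneg)
qed

text \<open>Only constraints containing 0 need checking. One with \<open>l\<close> interferers is
  implied by the \<open>l\<close>th term of the minimum, since the last \<open>l\<close> indices up
  to \<open>k\<close> carry the least power.\<close>

lemma joint_decoding_rate_symmetric: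
  assumes k: "k \<in> users K"
  shows "joint_decoding_rate K P0 I k \<in> symmetric_rates K P0 I"
proof (rule decodes_tagged_imp_symmetric_rate)
  let ?R = "joint_decoding_rate K P0 I k"
  show "0 \<le> ?R" using k by (rule joint_decoding_rate_nonneg)
  have sub: "{0..k} \<subseteq> users K" using k users_downward by auto
  have "real (card T) * ?R \<le> C (P T / (1 + noise {0..k}))" if T: "T \<subseteq> {0..k}" "0 \<in> T" for T
  proof -
    define B where "B = T - {0}"
    define l where "l = card B"
    have fin: "finite B" and B: "B \<subseteq> {1..k}"
      using T finite_subset[of T "{0..k}"] by (auto simp: B_def)
    have "0 \<notin> B" and T_eq: "T = insert 0 B" using T by (auto simp: B_def)
    have l: "l \<le> k" using B card_mono[of "{1..k}" B] by (simp add: l_def)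
    have I_le: "sum I {k - l + 1..k} \<le> sum I B"
    proof (rule sum_le_of_exchange)
      show "card {k - l + 1..k} = card B" using l by (simp add: l_def)
      show "I a \<le> I b" if "a \<in> {k - l + 1..k} - B" "b \<in> B - {k - l + 1..k}" for a b
        using that B sub by (intro I_antimono) auto
    qed (use fin in auto)
    have nn: "0 \<le> sum I {k - l + 1..k}"
      using sub by (intro sum_nonneg I_nonneg) (auto simp: users_def)
    have "?R \<le> 1 / real (l + 1) * C ((P0 + sum I {k - l + 1..k}) / (1 + noise {0..k}))"
      unfolding joint_decoding_rate_eq using l by (intro Min.coboundedI) auto
    then have "real (l + 1) * ?R \<le> C ((P0 + sum I {k - l + 1..k}) / (1 + noise {0..k}))"
      by (simp add: field_simps)
    also have "\<dots> \<le> C ((P0 + sum I B) / (1 + noise {0..k}))"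
      using P0 nn I_le P_nonneg[of "users K - {0..k}"]
      by (intro C_mono divide_right_mono divide_nonneg_nonneg) auto
    finally show ?thesis
      using fin \<open>0 \<notin> B\<close> by (simp add: P_insert_zero l_def T_eq del: of_nat_add)
  qed
  then show "decodes_tagged {0..k} ?R"
    using sub by (simp add: decodes_tagged_def)
qed

section \<open>Converse bound\<close>

lemma symmetric_rate_le_joint_decoding_rate:
  assumes "R \<in> symmetric_rates K P0 I"
  shows "\<exists>k\<in>users K. R \<le> joint_decoding_rate K P0 I k"
proof -
  obtain S where S: "S \<subseteq> users K" "0 \<in> S" and R: "0 \<le> R"
    and mac: "\<And>T. T \<subseteq> S \<Longrightarrow> (\<lambda>_. R) summable_on T \<and>
      (\<Sum>\<^sub>\<infinity>l\<in>T. R) \<le> C (P T / (1 + noise S))"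
    using assms by (auto simp: symmetric_rates_def capacity_region_def mac_region_def)
  show ?thesis
  proof (cases "finite S")
    case False
    then have "R = 0" using mac[of S] infsum_diverge_constant[of S R] by auto
    then show ?thesis using joint_decoding_rate_nonneg[OF zero_user] zero_user by auto
  next
    case True
    define A where "A = S - {0}"
    \<comment> \<open>The witness is the number of interferers that \<open>S\<close> decodes. It is
      itself a user: \<open>k\<close> distinct positive indices cannot all lie below
      \<open>k\<close>.\<close>
    define k where "k = card A"
    have fin: "finite A" and A: "A \<subseteq> users K" "A \<subseteq> {1..}" and S_eq: "S = insert 0 A"
      using True S by (auto simp: A_def)
    have k: "k \<in> users K"
    proof (cases "A = {}")
      case False
      have "A \<subseteq> {1..Max A}" using A fin by auto
      then have "k \<le> Max A" using card_mono[of "{1..Max A}" A] by (simp add: k_def)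
      then show ?thesis using Max_in[OF fin False] A users_downward by blast
    qed (simp add: k_def zero_user)
    have sub: "{0..k} \<subseteq> users K" using k users_downward by auto
    \<comment> \<open>Among indices above \<open>m\<close>, the strongest are those immediately
      after \<open>m\<close>. This is used with \<open>m = 0\<close> to compare decoded powers and
      with \<open>m = k - l\<close> to compare single constraints.\<close>
    have upper: "sum I B \<le> sum I {m + 1..m + card B}" if "B \<subseteq> A" "B \<subseteq> {m + 1..}" for m B
    proof (rule sum_le_of_exchange)
      show "I a \<le> I b" if "a \<in> B - {m + 1..m + card B}" "b \<in> {m + 1..m + card B} - B" for a b
        using that \<open>B \<subseteq> A\<close> \<open>B \<subseteq> {m + 1..}\<close> A by (intro I_antimono) auto
    qed (use that fin in \<open>auto intro: finite_subset\<close>)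
    have "P S \<le> P {0..k}"
    proof -
      have "P S = P0 + sum I A"
        using fin A by (subst S_eq, intro P_insert_zero) auto
      also have "\<dots> \<le> P0 + sum I {1..k}"
        using upper[of A 0] A by (simp add: k_def)
      also have "\<dots> = P (insert 0 {1..k})"
        by (intro P_insert_zero[symmetric]) auto
      also have "insert 0 {1..k} = {0..k}" by auto
      finally show ?thesis .
    qed
    \<comment> \<open>The total power is fixed, so more decoded power means less noise.\<close>
    then have noise_le: "noise {0..k} \<le> noise S"
      using sub S by (simp add: noise_eq)
    have "R \<le> 1 / real (l + 1) * C ((P0 + sum I {k - l + 1..k}) / (1 + noise {0..k}))"
      if l: "l \<le> k" for l
    proof -
      \<comment> \<open>Discarding at most \<open>k - l\<close> of the \<open>k\<close> elements of
        \<open>A\<close> leaves at least \<open>l\<close>, all with index above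
        \<open>k - l\<close>. Such a \<open>B\<close> is no stronger than the \<open>l\<close>
        weakest interferers of \<open>{0..k}\<close>, so its constraint gives the \<open>l\<close>th
        bound.\<close>
      have "l \<le> card (A - {1..k - l})"
        using diff_card_le_card_Diff[of "{1..k - l}" A] l by (simp add: k_def)
      then obtain B where B: "B \<subseteq> A - {1..k - l}" "card B = l" "finite B"
        using obtain_subset_with_card_n by metis
      then have B': "B \<subseteq> A" "B \<subseteq> {k - l + 1..}" "0 \<notin> B" using A by force+
      have I_le: "sum I B \<le> sum I {k - l + 1..k}"
        using upper[OF B'(1,2)] B l by simp
      have nn: "0 \<le> sum I B"
        using A B' by (intro sum_nonneg I_nonneg) (auto simp: users_def)
      have "real (l + 1) * R \<le> C (P (insert 0 B) / (1 + noise S))"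
        using mac[of "insert 0 B"] B B' S_eq by auto
      also have "\<dots> \<le> C ((P0 + sum I {k - l + 1..k}) / (1 + noise {0..k}))"
        using B B' P0 nn I_le noise_le P_nonneg[of "users K - {0..k}"]
        by (simp add: P_insert_zero) (intro C_mono frac_le divide_nonneg_nonneg; simp)
      finally show ?thesis by (simp add: field_simps)
    qed
    then have "R \<le> joint_decoding_rate K P0 I k"
      unfolding joint_decoding_rate_eq by (intro Min.boundedI) auto
    then show ?thesis using k by blast
  qed
qed

section \<open>Existence of the maximum\<close>

lemma joint_decoding_rate_decay:
  assumes "k \<in> users K"
  shows "joint_decoding_rate K P0 I k \<le> C (P (users K)) / real (k + 1)"
proof -
  have sub: "{0..k} \<subseteq> users K" using assms users_downward by auto
  \<comment> \<open>The term \<open>l = k\<close>, which involves all decoded users, supplies the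
    factor \<open>1 / (k + 1)\<close>.\<close>
  have "joint_decoding_rate K P0 I k
      \<le> 1 / real (k + 1) * C ((P0 + sum I {k - k + 1..k}) / (1 + noise {0..k}))"
    unfolding joint_decoding_rate_eq by (intro Min.coboundedI imageI) auto
  also have "P0 + sum I {k - k + 1..k} = P (insert 0 {1..k})"
    by (simp add: P_insert_zero)
  also have "insert 0 {1..k} = {0..k}" by auto
  also have "C (P {0..k} / (1 + noise {0..k})) \<le> C (P (users K))"
  proof (rule C_mono)
    have "P {0..k} / (1 + noise {0..k}) \<le> P {0..k} / 1"
      using P_nonneg[OF sub] P_nonneg[of "users K - {0..k}"] by (intro divide_left_mono) auto
    then show "P {0..k} / (1 + noise {0..k}) \<le> P (users K)"
      using P_mono[OF sub] by simp
  qed (rule SNR_nonneg[OF sub])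
  finally show ?thesis by (simp add: divide_right_mono)
qed

lemma joint_decoding_rate_le_R_sym:
  "k \<in> users K \<Longrightarrow> joint_decoding_rate K P0 I k \<le> R_sym K P0 I"
  unfolding R_sym_def
  by (intro cSup_upper joint_decoding_rate_symmetric symmetric_rates_bdd_above P0 I_nonneg)

lemma R_sym_attained: "\<exists>k\<in>users K. R_sym K P0 I = joint_decoding_rate K P0 I k"
proof (rule ccontr)
  assume "\<not> ?thesis"
  then have less: "joint_decoding_rate K P0 I k < R_sym K P0 I" if "k \<in> users K" for k
    using joint_decoding_rate_le_R_sym[OF that] that by force
  have pos: "0 < R_sym K P0 I"
    using less[OF zero_user] joint_decoding_rate_nonneg[OF zero_user] by linarith
  \<comment> \<open>Beyond this \<open>n\<close> the decay bound alone keeps the rates away from the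
    supremum.\<close>
  obtain n :: nat where n: "C (P (users K)) / R_sym K P0 I < real n"
    using reals_Archimedean2 by blast
  \<comment> \<open>One tail bound covers every \<open>k > n\<close>, and finitely many rates
    remain. If each of these is below the supremum, so is \<open>M\<close>, although
    \<open>M\<close> bounds all symmetric rates.\<close>
  define M where "M = Max (insert (C (P (users K)) / real (n + 1))
    (joint_decoding_rate K P0 I ` (users K \<inter> {..n})))"
  have "C (P (users K)) < real n * R_sym K P0 I"
    using n pos by (simp add: field_simps)
  then have "C (P (users K)) / real (n + 1) < R_sym K P0 I"
    using pos by (simp add: field_simps)
  then have "M < R_sym K P0 I"
    unfolding M_def using less by auto
  moreover have "R_sym K P0 I \<le> M"
    unfolding R_sym_def
  proof (rule cSup_least)
    show "symmetric_rates K P0 I \<noteq> {}"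
      by (intro symmetric_rates_nonempty P0 I_nonneg)
    fix R assume "R \<in> symmetric_rates K P0 I"
    then obtain k where k: "k \<in> users K" and R: "R \<le> joint_decoding_rate K P0 I k"
      using symmetric_rate_le_joint_decoding_rate by blast
    have "joint_decoding_rate K P0 I k \<le> M"
    proof (cases "k \<le> n")
      case True
      then show ?thesis unfolding M_def using k by (intro Max_ge) auto
    next
      case False
      have "joint_decoding_rate K P0 I k \<le> C (P (users K)) / real (k + 1)"
        using k by (rule joint_decoding_rate_decay)
      also have "\<dots> \<le> C (P (users K)) / real (n + 1)"
        using False C_nonneg[OF P_nonneg[OF order_refl]] by (intro divide_left_mono) auto
      also have "\<dots> \<le> M" unfolding M_def by (intro Max_ge) auto
      finally show ?thesis .
    qed
    with R show "R \<le> M" by linarith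
  qed
  ultimately show False by linarith
qed

end

theorem lemma2:
  fixes K :: enat and P0 :: real and I :: "nat \<Rightarrow> real"
  assumes "0 \<le> P0"
    and "\<And>i. 1 \<le> i \<Longrightarrow> enat i \<le> K \<Longrightarrow> 0 \<le> I i"
    and "\<And>i. 1 \<le> i \<Longrightarrow> enat (Suc i) \<le> K \<Longrightarrow> I (Suc i) \<le> I i"
    and "I summable_on {i. 1 \<le> i \<and> enat i \<le> K}"
  shows "(\<exists>k\<in>users K. R_sym K P0 I = joint_decoding_rate K P0 I k) \<and>
    (\<forall>k\<in>users K. joint_decoding_rate K P0 I k \<le> R_sym K P0 I)"
  using R_sym_attained[OF assms] joint_decoding_rate_le_R_sym[OF assms] by blast

end
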